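(* For every $k\in\mathbb{N}$, $S^{-1}(\psi(0,k))=R(\psi(0,k))$.
   Context: $\mathbb{N}=\{0,1,2,\ldots\}$ is an alphabet with its usual order. An overlap is a word $cxcxc$ with $c$ a letter and $x$ a possibly empty word; overlap-free means having no overlap as a factor. Lexicographic order: $x\le y$ if $x$ is a prefix of $y$ or $x=wcx'$, $y=wdy'$ with letters $c<d$. For $0\le h\le k$, $\psi(h,k)$ is the lexicographically least overlap-free word over $\mathbb{N}$ that starts with the letter $h$ and ends with the letter $k$. $S$ is the left cyclic shift $S(cx)=xc$ ($c$ a letter) and $S^{-1}$ its inverse, $S^{-1}(xc)=cx$. $R$ is reversal of words. *)

theory Defs
  imports Main "HOL-Library.Sublist" "HOL-Library.List_Lexorder"
begin

definition overlap :: "'a list \<Rightarrow> bool" where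
  "overlap w \<longleftrightarrow> (\<exists>c x. w = [c] @ x @ [c] @ x @ [c])"

definition overlap_free :: "'a list \<Rightarrow> bool" where
  "overlap_free w \<longleftrightarrow> \<not> (\<exists>v. sublist v w \<and> overlap v)"

text \<open>The order on words is the one of \<^theory>\<open>HOL-Library.List_Lexorder\<close>; in particular a
  prefix precedes its extensions. The word is only of interest for \<open>h \<le> k\<close>.\<close>

definition \<psi> :: "nat \<Rightarrow> nat \<Rightarrow> nat list" where
  "\<psi> h k = (LEAST w. overlap_free w \<and> w \<noteq> [] \<and> hd w = h \<and> last w = k)"

lemma word_le_iff:
  fixes x y :: "nat list"
  shows "x \<le> y \<longleftrightarrow> prefix x y \<or> (\<exists>w c d x' y'. x = w @ c # x' \<and> y = w @ d # y' \<and> c < d)"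
proof -
  have "x \<le> y \<longleftrightarrow> x = y \<or> (\<exists>a v. y = x @ a # v) \<or>
      (\<exists>w c d x' y'. c < d \<and> x = w @ c # x' \<and> y = w @ d # y')"
    by (auto simp: list_le_def list_less_def lexord_def)
  moreover have "prefix x y \<longleftrightarrow> x = y \<or> (\<exists>a v. y = x @ a # v)"
    by (metis append_Nil2 neq_Nil_conv prefix_def)
  ultimately show ?thesis by blast
qed

lemma bij_rotate1: "bij (rotate1 :: 'a list \<Rightarrow> 'a list)"
  unfolding bij_def
proof
  show "surj (rotate1 :: 'a list \<Rightarrow> 'a list)"
  proof (rule surjI)
    fix w :: "'a list"
    show "rotate1 (if w = [] then [] else last w # butlast w) = w"
      by simp
  qed
qed (rule inj_rotate1)

lemma inv_rotate1_snoc: "inv rotate1 (x @ [c]) = c # x"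
  by (rule inv_f_eq) (simp_all add: inj_rotate1)

end

theory Submission
  imports Defs
begin

text \<open>Put \<open>p\<^sub>0 = \<epsilon>\<close> and \<open>p\<^sub>k\<^sub>+\<^sub>1 = \<phi>(p\<^sub>k) k p\<^sub>k k p\<^sub>k\<close>, where \<open>\<phi>(j) = j p\<^sub>j j p\<^sub>j (j+1)\<close>, so that
  \<open>\<phi>(p\<^sub>k k) = p\<^sub>k\<^sub>+\<^sub>1 (k+1)\<close>. The word \<open>p\<^sub>k k\<close> is overlap-free, because \<open>\<phi>\<close> preserves this
  property, and greedy: replacing any letter by a smaller one creates an overlap that ends there.
  As \<open>k\<close> does not occur in \<open>p\<^sub>k\<close>, this gives \<open>\<psi>(0,k) = p\<^sub>k k\<close>, and the claim says that \<open>p\<^sub>k\<close> is a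
  palindrome. Now the reversal of \<open>p\<^sub>k\<close> turns out to be greedy as well, and two overlap-free greedy
  words of the same length are equal.\<close>

section \<open>Overlaps as factors, under reversal and by positions\<close>

lemma overlap_free_sublist: "overlap_free w \<Longrightarrow> sublist v w \<Longrightarrow> overlap_free v"
  unfolding overlap_free_def using sublist_order.order_trans by blast

lemma overlap_rev: "overlap (rev v) \<longleftrightarrow> overlap v"
proof -
  have "overlap (rev v)" if v: "overlap v" for v :: "'a list"
  proof -
    obtain c x where "v = [c] @ x @ [c] @ x @ [c]"
      using v unfolding overlap_def by blast
    then have "rev v = [c] @ rev x @ [c] @ rev x @ [c]" by simp
    then show ?thesis unfolding overlap_def by blast
  qed
  from this[of v] this[of "rev v"] show ?thesis by auto
qed

lemma overlap_free_rev: "overlap_free (rev w) \<longleftrightarrow> overlap_free w"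
  unfolding overlap_free_def by (metis overlap_rev rev_rev_ident sublist_rev)

lemma not_overlap_free_append: "\<not> overlap_free (u @ c # x @ c # x @ c # v)"
proof -
  have "sublist ([c] @ x @ [c] @ x @ [c]) (u @ ([c] @ x @ [c] @ x @ [c]) @ v)"
    by (rule sublist_appendI)
  then show ?thesis unfolding overlap_free_def overlap_def by fastforce
qed

lemma not_overlap_freeE:
  assumes "\<not> overlap_free w"
  obtains u c x v where "w = u @ c # x @ c # x @ c # v"
  using assms unfolding overlap_free_def overlap_def sublist_def by fastforce

text \<open>An overlap is a factor of length \<open>2 * d + 1\<close> with period \<open>d\<close>;
  the form by positions lets periods be carried through a morphism.\<close>

lemma not_overlap_free_nth:
  assumes "d > 0" "i + 2 * d < length w"
    and per: "\<And>q. i \<le> q \<Longrightarrow> q \<le> i + d \<Longrightarrow> w ! q = w ! (q + d)"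
  shows "\<not> overlap_free w"
proof -
  define x where "x = take (d - 1) (drop (i + 1) w)"
  define z where "z = take (2 * d + 1) (drop i w)"
  have len: "length x = d - 1" "length z = 2 * d + 1"
    using assms(1,2) by (auto simp: x_def z_def)
  have "z = (w ! i) # x @ (w ! i) # x @ [w ! i]"
  proof (rule nth_equalityI)
    show "length z = length ((w ! i) # x @ (w ! i) # x @ [w ! i])"
      using len assms(1) by simp
  next
    fix t assume t: "t < length z"
    then have zt: "z ! t = w ! (i + t)"
      using assms(2) by (simp add: z_def len)
    have xt: "x ! r = w ! (i + 1 + r)" if "r < d - 1" for r
      using that assms(2) by (simp add: x_def)
    consider "t = 0" | "1 \<le> t" "t < d" | "t = d" | "d < t" "t < 2 * d" | "t = 2 * d"
      using t len by linarith
    then show "z ! t = ((w ! i) # x @ (w ! i) # x @ [w ! i]) ! t"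
    proof cases
      case 1 then show ?thesis using zt by simp
    next
      case 2
      then have "((w ! i) # x @ (w ! i) # x @ [w ! i]) ! t = x ! (t - 1)"
        using len by (auto simp: nth_Cons' nth_append)
      then show ?thesis using 2 zt xt[of "t - 1"] by simp
    next
      case 3
      then have "((w ! i) # x @ (w ! i) # x @ [w ! i]) ! t = w ! i"
        using len assms(1) by (simp add: nth_Cons' nth_append)
      then show ?thesis using 3 zt per[of i] by simp
    next
      case 4
      then have "((w ! i) # x @ (w ! i) # x @ [w ! i]) ! t = x ! (t - d - 1)"
        using len assms(1) by (auto simp: nth_Cons' nth_append)
      moreover have "i + 1 + (t - d - 1) = i + (t - d)" using 4 by simp
      ultimately show ?thesis using 4 zt xt[of "t - d - 1"] per[of "i + (t - d)"] by simp
    next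
      case 5
      then have "((w ! i) # x @ (w ! i) # x @ [w ! i]) ! t = w ! i"
        using len assms(1) by (auto simp: nth_Cons' nth_append)
      then show ?thesis using 5 zt per[of i] per[of "i + d"] by (simp add: mult_2 add.assoc)
    qed
  qed
  moreover have "w = take i w @ z @ drop (2 * d + 1) (drop i w)"
    unfolding z_def by (metis append_take_drop_id)
  ultimately have "w = take i w @ (w ! i) # x @ (w ! i) # x @ (w ! i) # drop (2 * d + 1) (drop i w)"
    by simp
  then show ?thesis using not_overlap_free_append by metis
qed

lemma not_overlap_free_nthE:
  assumes "\<not> overlap_free w"
  obtains i d where "d > 0" "i + 2 * d < length w"
    "\<And>q. i \<le> q \<Longrightarrow> q \<le> i + d \<Longrightarrow> w ! q = w ! (q + d)"
proof -
  obtain u c x v where w: "w = u @ c # x @ c # x @ c # v"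
    using assms by (rule not_overlap_freeE)
  show ?thesis
  proof (rule that[of "length x + 1" "length u"])
    show "length u + 2 * (length x + 1) < length w" using w by simp
  next
    fix q assume q: "length u \<le> q" "q \<le> length u + (length x + 1)"
    define t where "t = q - length u"
    have t: "q = length u + t" "t \<le> length x + 1" using q by (auto simp: t_def)
    then consider "t = 0" | s where "t = Suc s" "s < length x" | "t = Suc (length x)"
      by (cases t) force+
    then show "w ! q = w ! (q + (length x + 1))"
      by cases (auto simp: w t(1) nth_append)
  qed simp
qed

section \<open>Greedy words\<close>

text \<open>The context \<open>a\<close> allows greediness to be checked block by block;
  \<open>greedy_after_append\<close> joins the blocks.\<close>

definition greedy_after :: "nat list \<Rightarrow> nat list \<Rightarrow> bool" where
  "greedy_after a w \<longleftrightarrow> (\<forall>u c v d. w = u @ c # v \<longrightarrow> d < c \<longrightarrow> \<not> overlap_free (a @ u @ [d]))"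

lemma greedy_after_Nil [simp]: "greedy_after a []"
  by (simp add: greedy_after_def)

lemma greedy_after_append:
  assumes "greedy_after a x" "greedy_after (a @ x) y"
  shows "greedy_after a (x @ y)"
  unfolding greedy_after_def
proof (intro allI impI)
  fix u c v d assume eq: "x @ y = u @ c # v" and "d < c"
  show "\<not> overlap_free (a @ u @ [d])"
  proof (cases "\<exists>v'. x = u @ c # v'")
    case True
    then show ?thesis using assms(1) \<open>d < c\<close> unfolding greedy_after_def by blast
  next
    case False
    then obtain u' where "u = x @ u'" "y = u' @ c # v"
      using eq by (auto simp: append_eq_append_conv2 append_eq_Cons_conv)
    then show ?thesis using assms(2) \<open>d < c\<close> unfolding greedy_after_def by fastforce
  qed
qed

lemma greedy_after_prefix: "greedy_after a (x @ y) \<Longrightarrow> greedy_after a x"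
  unfolding greedy_after_def by (metis append.assoc append_Cons)

text \<open>A longer context only adds factors, so the overlaps that forbid smaller letters
  persist.\<close>

lemma greedy_afterI_Nil:
  assumes "greedy_after [] w"
  shows "greedy_after a w"
  using assms unfolding greedy_after_def
  by (metis append_Nil overlap_free_sublist sublist_append_leftI)

lemma greedy_after_single:
  assumes "\<And>d. d < c \<Longrightarrow> \<not> overlap_free (a @ [d])"
  shows "greedy_after a [c]"
  using assms unfolding greedy_after_def by (auto simp: Cons_eq_append_conv)

lemma greedy_after_snocD:
  "greedy_after a (u @ [c]) \<Longrightarrow> d < c \<Longrightarrow> \<not> overlap_free (a @ u @ [d])"
  unfolding greedy_after_def by blast

text \<open>At the first difference, a smaller letter of \<open>y\<close> would end an overlap
  inside \<open>y\<close>. The second alternative covers the proper prefixes of \<open>w\<close>,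
  which precede \<open>w\<close>.\<close>

lemma greedy_le:
  assumes "greedy_after [] w" "overlap_free y"
  shows "w \<le> y \<or> prefix y w"
proof (cases "prefix w y \<or> prefix y w")
  case True
  then show ?thesis by (auto simp: word_le_iff)
next
  case False
  then have "w \<parallel> y" by blast
  then obtain s c d w' y' where *: "c \<noteq> d" "w = s @ c # w'" "y = s @ d # y'"
    using parallel_decomp by blast
  have "\<not> d < c"
  proof
    assume "d < c"
    then have "\<not> overlap_free (s @ [d])"
      using assms(1) * unfolding greedy_after_def by force
    moreover have "sublist (s @ [d]) y"
      using * by (metis append.assoc append_Cons append_Nil prefixI prefix_imp_sublist)
    ultimately show False using assms(2) overlap_free_sublist by blast
  qed
  then show ?thesis using * by (metis linorder_neqE_nat word_le_iff)
qed

lemma greedy_unique: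
  assumes "greedy_after [] w" "overlap_free w" "greedy_after [] y" "overlap_free y"
    "length w = length y"
  shows "w = y"
  using greedy_le[OF assms(1,4)] greedy_le[OF assms(3,2)] assms(5)
  by (metis antisym not_equal_is_parallel parallelE prefix_order.eq_iff word_le_iff)

text \<open>Marking the first letter of each image suffices to transport an overlap.\<close>

lemma not_overlap_free_image:
  assumes "\<not> overlap_free (v @ [d])" "\<And>a. f a = g a # t a"
  shows "\<not> overlap_free (concat (map f v) @ [g d])"
proof -
  obtain a c x b where v: "v @ [d] = a @ c # x @ c # x @ c # b"
    using assms(1) by (rule not_overlap_freeE)
  let ?m = "\<lambda>u. concat (map f u)"
  have nof: "\<not> overlap_free (?m a @ ?m (c # x) @ ?m (c # x) @ g c # y)" for y
    using not_overlap_free_append[of "?m a" "g c" "t c @ ?m x" y] assms(2) by simp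
  \<comment> \<open>The overlap either ends at the final \<open>d\<close>, of whose image only the
    mark is kept, or lies within \<open>v\<close>.\<close>
  show ?thesis
  proof (cases b rule: rev_cases)
    case Nil
    then have "v = a @ c # x @ c # x" "d = c"
      using v by (metis append.assoc append_Cons append1_eq_conv)+
    then show ?thesis using nof[of "[]"] by simp
  next
    case (snoc b' e)
    then have "v @ [d] = (a @ c # x @ c # x @ c # b') @ [e]" using v by simp
    then have "v = a @ c # x @ c # x @ c # b'" by blast
    then show ?thesis using nof[of "t c @ ?m b' @ [g d]"] assms(2) by simp
  qed
qed

section \<open>The morphism\<close>

text \<open>The guard only serves termination: all letters of \<open>pal k\<close> are below \<open>k\<close>.\<close>

function pal :: "nat \<Rightarrow> nat list" where
  "pal 0 = []"
| "pal (Suc k) =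
    concat (map (\<lambda>j. if j < Suc k then [j] @ pal j @ [j] @ pal j @ [Suc j] else []) (pal k))
    @ [k] @ pal k @ [k] @ pal k"
  by pat_completeness auto
termination by (relation "measure id") auto

declare pal.simps(2) [simp del]

text \<open>The morphism phi on letters; by \<open>set_pal\<close> the guard in \<open>pal\<close>
  always holds, which yields \<open>pal_Suc\<close>.\<close>

definition img :: "nat \<Rightarrow> nat list" where
  "img j = [j] @ pal j @ [j] @ pal j @ [Suc j]"

lemma set_pal: "set (pal k) \<subseteq> {..<k}"
proof (induction k rule: less_induct)
  case (less k)
  show ?case
  proof (cases k)
    case (Suc n)
    have "set (pal n) \<subseteq> {..<n}" using less Suc by simp
    moreover have "set (pal j) \<subseteq> {..<j}" if "j < k" for j using less that by simp
    ultimately show ?thesis using Suc by (fastforce simp: pal.simps(2) split: if_splits)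
  qed simp
qed

lemma pal_Suc: "pal (Suc k) = concat (map img (pal k)) @ [k] @ pal k @ [k] @ pal k"
proof -
  have "map (\<lambda>j. if j < Suc k then [j] @ pal j @ [j] @ pal j @ [Suc j] else []) (pal k)
    = map img (pal k)"
    using set_pal[of k] by (auto simp: img_def)
  then show ?thesis by (simp only: pal.simps(2))
qed

text \<open>The tail of \<open>pal (Suc k)\<close> is the image of \<open>k\<close> without its last
  letter. So \<open>pal k @ [k]\<close> arises from \<open>[0]\<close> by applying the morphism
  \<open>k\<close> times.\<close>

lemma pal_Suc_snoc: "pal (Suc k) @ [Suc k] = concat (map img (pal k @ [k]))"
  by (simp add: pal_Suc img_def)

lemma last_pal: "k > 0 \<Longrightarrow> pal k \<noteq> [] \<and> last (pal k) = 0"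
proof (induction k)
  case (Suc k)
  then show ?case by (cases k) (auto simp: pal_Suc)
qed simp

lemma pal_snoc_Cons: "\<exists>r. pal k @ [k] = 0 # r"
proof (induction k)
  case (Suc k)
  then obtain r where "pal k @ [k] = 0 # r" by blast
  then show ?case unfolding pal_Suc_snoc by (simp add: img_def)
qed simp

text \<open>By strong induction, the factors \<open>pal j @ [j]\<close> of the images are greedy in
  every context. Only the first and the last letter of each image need an argument.\<close>

lemma greedy_pal_snoc: "greedy_after [] (pal k @ [k])"
proof (induction k rule: less_induct)
  case (less k)
  show ?case
  proof (cases k)
    case 0
    then show ?thesis by (auto intro: greedy_after_single)
  next
    case (Suc n)
    have W: "greedy_after a (pal j @ [j])" if "j \<le> n" for j a
      using less[of j] that Suc by (auto intro: greedy_afterI_Nil)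
    have img: "greedy_after a (img j)"
      if "j \<le> n" "\<And>d. d < j \<Longrightarrow> \<not> overlap_free (a @ [d])" for j a
    proof -
      have "greedy_after (a @ [j] @ pal j @ [j] @ pal j) [Suc j]"
      proof (rule greedy_after_single)
        fix d assume "d < Suc j"
        \<comment> \<open>A letter below \<open>j\<close> is forbidden by the greediness of
          \<open>pal j @ [j]\<close> after the second \<open>j\<close>; the letter \<open>j\<close>
          itself completes an overlap with period \<open>length (pal j) + 1\<close>.\<close>
        then consider "d < j" | "d = j" by linarith
        then show "\<not> overlap_free ((a @ [j] @ pal j @ [j] @ pal j) @ [d])"
        proof cases
          case 1
          then show ?thesis
            using greedy_after_snocD[OF W[OF that(1), of "a @ [j] @ pal j @ [j]"]] by simp
        next
          case 2
          then show ?thesis using not_overlap_free_append[of a j "pal j" "[]"] by simp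
        qed
      qed
      moreover have "greedy_after a [j]"
        using that(2) by (rule greedy_after_single)
      moreover have "greedy_after (a @ [j]) (pal j @ [j])"
        using W[OF that(1)] .
      moreover have "greedy_after (a @ [j] @ pal j @ [j]) (pal j)"
        using W[OF that(1)] by (rule greedy_after_prefix)
      ultimately have "greedy_after a ([j] @ (pal j @ [j]) @ pal j @ [Suc j])"
        using greedy_after_append[of a "[j]"] greedy_after_append[of "a @ [j]" "pal j @ [j]"]
          greedy_after_append[of "a @ [j] @ pal j @ [j]" "pal j"] by simp
      then show ?thesis by (simp add: img_def)
    qed
    have "greedy_after [] (concat (map img u))" if "prefix u (pal n @ [n])" for u
      using that
    proof (induction u rule: rev_induct)
      case (snoc j u)
      have "j \<in> set (pal n @ [n])" using set_mono_prefix[OF snoc.prems] by simp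
      then have "j \<le> n" using set_pal[of n] by auto
      \<comment> \<open>Greediness of \<open>pal n @ [n]\<close> gives an overlap in
        \<open>u @ [d]\<close>, and the image of \<open>d\<close> begins with
        \<open>d\<close>.\<close>
      moreover have "\<not> overlap_free (concat (map img u) @ [d])" if "d < j" for d
      proof (rule not_overlap_free_image)
        obtain v where "pal n @ [n] = (u @ [j]) @ v" using snoc.prems by (auto simp: prefix_def)
        then show "\<not> overlap_free (u @ [d])"
          using greedy_after_snocD greedy_after_prefix W[of n "[]"] \<open>d < j\<close>
          by (metis append_Nil le_refl)
      qed (simp add: img_def)
      moreover have "prefix u (pal n @ [n])"
        using snoc.prems append_prefixD by blast
      ultimately show ?case using snoc.IH img by (simp add: greedy_after_append)
    qed simp
    from this[of "pal n @ [n]"] show ?thesis using Suc pal_Suc_snoc by simp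
  qed
qed

section \<open>Overlaps in images of a morphism\<close>

abbreviation image_pos :: "('a \<Rightarrow> 'b list) \<Rightarrow> 'a list \<Rightarrow> nat \<Rightarrow> nat" where
  "image_pos f u l \<equiv> length (concat (map f (take l u)))"

lemma image_pos_Suc: "l < length u \<Longrightarrow> image_pos f u (Suc l) = image_pos f u l + length (f (u ! l))"
  by (simp add: take_Suc_conv_app_nth)

lemma image_pos_mono: "l \<le> l' \<Longrightarrow> image_pos f u l \<le> image_pos f u l'"
  by (metis append_take_drop_id concat_append le_add1 length_append map_append min_absorb1 take_take)

lemma nth_image:
  assumes "l < length u" "t < length (f (u ! l))"
  shows "concat (map f u) ! (image_pos f u l + t) = f (u ! l) ! t"
proof -
  have "concat (map f u) =
      concat (map f (take l u)) @ f (u ! l) @ concat (map f (drop (Suc l) u))"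
    using id_take_nth_drop[OF assms(1)]
    by (metis concat.simps(2) concat_append list.simps(9) map_append)
  then show ?thesis using assms(2) by (metis nth_append nth_append_length_plus)
qed

lemma image_posE:
  assumes "q < length (concat (map f u))"
  obtains l where "l < length u" "image_pos f u l \<le> q" "q < image_pos f u (Suc l)"
proof -
  let ?P = "\<lambda>l. q < image_pos f u l"
  have ex: "?P (length u)" using assms by simp
  have n0: "\<not> ?P 0" by simp
  obtain l where l: "\<not> ?P l" "?P (Suc l)" "Suc l \<le> length u"
    using ex_least_nat_less[of ?P, OF ex n0] by auto
  then show ?thesis by (intro that[of l]) auto
qed

text \<open>If an overlap has two letters at distance \<open>d\<close> at which images end, then the marked first
  letters decode the period to the right, and the marked last letters decode it to the left.\<close>

lemma overlap_desubst:
  fixes f :: "'a \<Rightarrow> 'b list"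
  assumes ne: "\<And>a. f a \<noteq> []"
    and hd: "\<And>a b. hd (f a) = hd (f b) \<Longrightarrow> a = b"
    and last: "\<And>a b. last (f a) = last (f b) \<Longrightarrow> a = b"
    and d: "d > 0" "i + 2 * d < length (concat (map f u))"
    and per: "\<And>q. i \<le> q \<Longrightarrow> q \<le> i + d \<Longrightarrow>
      concat (map f u) ! q = concat (map f u) ! (q + d)"
    and sync: "i < image_pos f u j" "image_pos f u j \<le> i + d + 1"
      "image_pos f u j' = image_pos f u j + d" "j' \<le> length u"
  shows "\<not> overlap_free u"
proof -
  let ?F = "concat (map f u)"
  let ?B = "image_pos f u"
  define e where "e = j' - j"
  have "j < j'"
    using image_pos_mono[of j' j f u] sync d(1) by linarith
  then have e: "e > 0" "j + e = j'" by (auto simp: e_def)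
  have first: "?F ! ?B l = hd (f (u ! l))" if "l < length u" for l
    using nth_image[OF that, of 0 f] ne by (simp add: hd_conv_nth)
  have final: "?F ! (?B (Suc l) - 1) = last (f (u ! l))" if "l < length u" for l
    using nth_image[OF that, of "length (f (u ! l)) - 1" f] ne image_pos_Suc[OF that, of f]
    by (simp add: last_conv_nth Suc_leI)
  \<comment> \<open>Equal first letters give equal letters of \<open>u\<close>, hence blocks of
    equal length, so the shift by \<open>d\<close> passes on to the next boundary.\<close>
  have fwd: "?B l \<le> i + d \<Longrightarrow> ?B (l + e) = ?B l + d \<and> l + e < length u \<and> u ! l = u ! (l + e)"
    if "j \<le> l" for l
    using that
  proof (induction l rule: dec_induct)
    case base
    have "?B (j + e) = ?B j + d" using sync e by simp
    moreover from this have "j + e < length u"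
      using base d(2) by (metis add_le_mono1 group_cancel.add1 leD linorder_le_less_linear
          mult_2 take_all)
    ultimately show ?case
      using per[of "?B j"] first[of j] first[of "j + e"] hd sync(1) base by force
  next
    case (step l)
    have "?B l \<le> ?B (Suc l)" by (rule image_pos_mono) simp
    then have IH: "?B (l + e) = ?B l + d" "l + e < length u" "u ! l = u ! (l + e)"
      using step by auto
    then have B: "?B (Suc l + e) = ?B (Suc l) + d"
      using image_pos_Suc[of l u f] image_pos_Suc[of "l + e" u f] by simp
    moreover have "Suc l + e < length u"
    proof (rule ccontr)
      assume "\<not> ?thesis"
      then have "?B (Suc l + e) = length ?F" by simp
      then show False using B step.prems d(2) by linarith
    qed
    moreover have "i \<le> ?B (Suc l)"
      using image_pos_mono[of j "Suc l" f u] step(1) sync(1) by simp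
    ultimately show ?case
      using per[of "?B (Suc l)"] first[of "Suc l"] first[of "Suc l + e"] hd step.prems by force
  qed
  \<comment> \<open>At \<open>l = j\<close> only the boundary is claimed. For \<open>l < j\<close>,
    the condition \<open>i < ?B (Suc l)\<close> puts the last letter of block \<open>l\<close>
    inside the overlap.\<close>
  have bwd: "(l < j \<longrightarrow> i < ?B (Suc l)) \<longrightarrow> ?B (l + e) = ?B l + d \<and> (l < j \<longrightarrow> u ! l = u ! (l + e))"
    if "l \<le> j" for l
    using that
  proof (induction l rule: inc_induct)
    case base
    then show ?case using sync e by simp
  next
    case (step l)
    show ?case
    proof (intro impI)
      assume "l < j \<longrightarrow> i < ?B (Suc l)"
      then have i: "i < ?B (Suc l)" using step by simp
      then have "i < ?B (Suc (Suc l))"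
        using image_pos_mono[of "Suc l" "Suc (Suc l)" f u] by linarith
      then have B: "?B (Suc l + e) = ?B (Suc l) + d" using step.IH by simp
      have lu: "l < length u" "l + e < length u" using step e sync(4) by auto
      have "?B (Suc l) \<le> i + d + 1"
        using image_pos_mono[of "Suc l" j f u] step sync(2) by simp
      then have "?F ! (?B (Suc l) - 1) = ?F ! (?B (Suc l) - 1 + d)"
        using i by (intro per) auto
      also have "?B (Suc l) - 1 + d = ?B (Suc (l + e)) - 1" using B i by simp
      finally have "u ! l = u ! (l + e)" using final lu last by simp
      then show "?B (l + e) = ?B l + d \<and> (l < j \<longrightarrow> u ! l = u ! (l + e))"
        using image_pos_Suc[OF lu(1), of f] image_pos_Suc[OF lu(2), of f] B by simp
    qed
  qed
  \<comment> \<open>The overlap of \<open>u\<close> starts at the block containing position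
    \<open>i\<close>, even if that block begins before \<open>i\<close>.\<close>
  obtain s where s: "s < length u" "?B s \<le> i" "i < ?B (Suc s)"
    using image_posE[of i f u] d(2) by auto
  have "s < j" using s(2) sync(1) image_pos_mono[of j s f u] by linarith
  have eq: "u ! l = u ! (l + e) \<and> l + e < length u" if "s \<le> l" "l \<le> s + e" for l
  proof (cases "l < j")
    case True
    then have "i < ?B (Suc l)" using s(3) image_pos_mono[of "Suc s" "Suc l" f u] that by linarith
    then show ?thesis using bwd[of l] True e sync(4) by auto
  next
    case False
    have "?B (s + e) = ?B s + d" using bwd[of s] s \<open>s < j\<close> by simp
    then have "?B l \<le> i + d" using image_pos_mono[of l "s + e" f u] that s(2) by linarith
    then show ?thesis using fwd[of l] False by simp
  qed
  show ?thesis
  proof (rule not_overlap_free_nth[of e s])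
    show "s + 2 * e < length u" using eq[of "s + e"] by simp
  qed (use e eq in auto)
qed

section \<open>The morphism preserves overlap-freeness\<close>

lemma length_img: "length (img j) = 2 * length (pal j) + 3"
  by (simp add: img_def)

lemma nth_img:
  shows "img j ! 0 = j"
    and "img j ! (length (pal j) + 1) = j"
    and "img j ! (2 * length (pal j) + 2) = Suc j"
    and "t < length (pal j) \<Longrightarrow> img j ! (t + 1) = pal j ! t"
    and "t < length (pal j) \<Longrightarrow> img j ! (length (pal j) + 2 + t) = pal j ! t"
  by (auto simp: img_def nth_append nth_Cons')

text \<open>The letters of \<open>pal j\<close> are below \<open>j\<close>, so a letter that is at
  least \<open>j\<close> has only three possible positions. This locates the largest letter of an
  overlap.\<close>

lemma nth_img_cases:
  assumes "t < length (img j)"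
  obtains "t = 0" | "t = length (pal j) + 1" | "t = 2 * length (pal j) + 2"
    | "img j ! t < j" "0 < t" "t \<noteq> length (pal j) + 1" "t < 2 * length (pal j) + 2"
proof -
  have lt: "pal j ! r < j" if "r < length (pal j)" for r
    using set_pal[of j] nth_mem[OF that] by auto
  consider "t = 0" | "t = length (pal j) + 1" | "t = 2 * length (pal j) + 2"
    | "0 < t" "t < length (pal j) + 1" | "length (pal j) + 1 < t" "t < 2 * length (pal j) + 2"
    using assms unfolding length_img by linarith
  then show ?thesis
  proof cases
    case 4
    then show ?thesis using nth_img(4)[of "t - 1" j] lt[of "t - 1"] that(4) by simp
  next
    case 5
    define r where "r = t - (length (pal j) + 2)"
    have "t = length (pal j) + 2 + r" "r < length (pal j)"
      using 5 by (auto simp: r_def)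
    then show ?thesis using 5 nth_img(5)[of r j] lt[of r] that(4) by simp
  qed (use that in auto)
qed

text \<open>The last letter of an image follows a 0, whereas the first letter of a later image
  follows the positive end of its predecessor. This tells the two apart.\<close>

lemma img_penultimate: "img j ! (2 * length (pal j) + 1) = 0"
proof (cases "j = 0")
  case True
  then show ?thesis by (simp add: img_def)
next
  case False
  then have "pal j \<noteq> []" "last (pal j) = 0" using last_pal by auto
  moreover from this have "length (pal j) + 2 + (length (pal j) - 1) = 2 * length (pal j) + 1"
    by (cases "pal j") auto
  ultimately show ?thesis
    using nth_img(5)[of "length (pal j) - 1" j]
    by (metis diff_less last_conv_nth length_greater_0_conv zero_less_one)
qed

text \<open>Let \<open>m\<close> be the largest letter of an overlap in the image. It only meets images of letters
  up to \<open>m\<close>, and not that of \<open>m\<close> itself, so that \<open>m\<close> only occurs as the last letter of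
  \<open>img (m - 1)\<close>; hence \<^term>\<open>overlap_desubst\<close> applies.\<close>

lemma overlap_free_image:
  assumes u: "overlap_free u" and pal: "\<And>j. j \<in> set u \<Longrightarrow> overlap_free (pal j)"
  shows "overlap_free (concat (map img u))"
proof (rule ccontr)
  let ?F = "concat (map img u)"
  let ?B = "image_pos img u"
  let ?n = "\<lambda>l. length (pal (u ! l))"
  assume "\<not> overlap_free ?F"
  then obtain d i where d: "d > 0" "i + 2 * d < length ?F"
    and per: "\<And>q. i \<le> q \<Longrightarrow> q \<le> i + d \<Longrightarrow> ?F ! q = ?F ! (q + d)"
    using not_overlap_free_nthE by blast
  define m where "m = Max ((!) ?F ` {i..i + 2 * d})"
  have le: "?F ! q \<le> m" if "i \<le> q" "q \<le> i + 2 * d" for q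
    using that by (auto simp: m_def)
  have "m \<in> (!) ?F ` {i..i + 2 * d}" unfolding m_def by (rule Max_in) auto
  then obtain q where "i \<le> q" "q \<le> i + 2 * d" "?F ! q = m" by auto
  \<comment> \<open>In either half of the overlap, the maximum has a copy at distance
    \<open>d\<close>.\<close>
  then obtain r where r: "i \<le> r" "r \<le> i + d" "?F ! r = m" "?F ! (r + d) = m"
  proof (cases "q \<le> i + d")
    case False
    then show ?thesis
      using that[of "q - d"] per[of "q - d"] \<open>q \<le> i + 2 * d\<close> \<open>?F ! q = m\<close> by simp
  qed (use that[of q] per[of q] in auto)
  have F: "?F ! (?B l + t) = img (u ! l) ! t" if "l < length u" "t < 2 * ?n l + 3" for l t
    using nth_image[of l u t img] that by (simp add: length_img)
  have B_Suc: "?B (Suc l) = ?B l + 2 * ?n l + 3" if "l < length u" for l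
    using image_pos_Suc[OF that, of img] by (simp add: length_img)
  have F0: "?F ! ?B l = u ! l" "?F ! (?B l + ?n l + 1) = u ! l"
    "?F ! (?B l + 2 * ?n l + 2) = Suc (u ! l)" "?F ! (?B l + 2 * ?n l + 1) = 0"
    if "l < length u" for l
    using F[OF that, of 0] F[OF that, of "?n l + 1"] F[OF that, of "2 * ?n l + 2"]
      F[OF that, of "2 * ?n l + 1"] nth_img[where j = "u ! l"] img_penultimate[of "u ! l"]
    by (simp_all add: add.assoc)
  have before: "?F ! (?B l - 1) > 0" if l: "l < length u" "?B l > 0" for l
  proof -
    obtain l' where "l = Suc l'" using l by (cases l) auto
    then show ?thesis using F0(3)[of l'] B_Suc[of l'] l by (simp add: numeral_3_eq_3)
  qed
  \<comment> \<open>Otherwise the three marked letters of the block exceed \<open>m\<close>, so the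
    overlap avoids them and lies inside one copy of the overlap-free
    \<open>pal (u ! l)\<close>.\<close>
  have upper: "u ! l \<le> m"
    if l: "l < length u" and q: "?B l \<le> q" "q < ?B (Suc l)" "i \<le> q" "q \<le> i + 2 * d" for l q
  proof (rule ccontr)
    assume m: "\<not> u ! l \<le> m"
    have avoid: "\<not> (i \<le> p \<and> p \<le> i + 2 * d)"
      if "p \<in> {?B l, ?B l + ?n l + 1, ?B l + 2 * ?n l + 2}" for p
      using that F0(1-3)[OF l] le[of p] m by auto
    have inside: False
      if a: "a \<le> i" "i + 2 * d < a + ?n l"
        and eq: "\<And>t. t < ?n l \<Longrightarrow> ?F ! (a + t) = pal (u ! l) ! t" for a
    proof -
      have "\<not> overlap_free (pal (u ! l))"
      proof (rule not_overlap_free_nth[of d "i - a"])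
        fix p assume p: "i - a \<le> p" "p \<le> i - a + d"
        then have "?F ! (a + p) = ?F ! (a + (p + d))"
          using per[of "a + p"] a by (simp add: add.assoc)
        then show "pal (u ! l) ! p = pal (u ! l) ! (p + d)"
          using eq[of p] eq[of "p + d"] p a by simp
      qed (use a d in auto)
      then show False using pal l by simp
    qed
    have "(?B l < i \<and> i + 2 * d < ?B l + ?n l + 1) \<or>
        (?B l + ?n l + 1 < i \<and> i + 2 * d < ?B l + 2 * ?n l + 2)"
      using avoid[of "?B l"] avoid[of "?B l + ?n l + 1"] avoid[of "?B l + 2 * ?n l + 2"]
        q B_Suc[OF l] by simp linarith
    then show False
    proof
      assume "?B l < i \<and> i + 2 * d < ?B l + ?n l + 1"
      then show False
        using inside[of "?B l + 1"] F[OF l, of "t + 1" for t] nth_img(4)[where j = "u ! l"] by force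
    next
      assume "?B l + ?n l + 1 < i \<and> i + 2 * d < ?B l + 2 * ?n l + 2"
      then show False
        using inside[of "?B l + (?n l + 2)"] F[OF l, of "?n l + 2 + t" for t]
          nth_img(5)[where j = "u ! l"] by (force simp: add.assoc)
    qed
  qed
  \<comment> \<open>In the image of a letter below \<open>m\<close>, only the final successor can
    reach \<open>m\<close>.\<close>
  have ends: "q = ?B (Suc l) - 1 \<and> m = Suc (u ! l)"
    if l: "l < length u" and q: "?B l \<le> q" "q < ?B (Suc l)" "i \<le> q" "q \<le> i + 2 * d"
      and m: "?F ! q = m" "u ! l < m" for l q
  proof -
    define t where "t = q - ?B l"
    have t: "q = ?B l + t" "t < 2 * ?n l + 3" using q B_Suc[OF l] by (auto simp: t_def)
    then have m_t: "img (u ! l) ! t = m" using F[OF l] m by simp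
    have "t < length (img (u ! l))" using t by (simp add: length_img)
    then show ?thesis
      by (cases rule: nth_img_cases) (use m m_t t B_Suc[OF l] nth_img[where j = "u ! l"] in auto)
  qed
  \<comment> \<open>If \<open>u ! l = m\<close>, the overlap stops before the final
    \<open>Suc m\<close>, and \<open>m\<close> can occur in the block only at its two other
    marks.\<close>
  have strict: "u ! l < m"
    if l: "l < length u" and q: "?B l \<le> q" "q < ?B (Suc l)" "i \<le> q" "q \<le> i + 2 * d" for l q
  proof (rule ccontr)
    assume "\<not> u ! l < m"
    then have m: "u ! l = m" using upper[OF that] by simp
    then have stop: "i + 2 * d < ?B l + 2 * ?n l + 2"
      using le[of "?B l + 2 * ?n l + 2"] F0(3)[OF l] q B_Suc[OF l] by force
    have in_l: "p = ?B l \<or> p = ?B l + ?n l + 1"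
      if "?B l \<le> p" "p \<le> i + 2 * d" "?F ! p = m" for p
    proof -
      define t where "t = p - ?B l"
      have t: "p = ?B l + t" "t < 2 * ?n l + 2" using that stop by (auto simp: t_def)
      then have m_t: "img (u ! l) ! t = m" using F[OF l] that by simp
      have "t < length (img (u ! l))" using t by (simp add: length_img)
      then show ?thesis
        by (cases rule: nth_img_cases) (use m m_t t in auto)
    qed
    show False
    \<comment> \<open>If the overlap starts after the first mark, a single mark is left for both
      \<open>r\<close> and \<open>r + d\<close>.\<close>
    proof (cases "?B l < i")
      case True
      then show False using in_l[of r] in_l[of "r + d"] r d by auto
    next
      case False
      have bpos: "?B l > 0" if "i < ?B l" using that by linarith
      show False
      \<comment> \<open>The \<open>m\<close> at \<open>?B l\<close> has a left copy at
        \<open>?B l - d\<close>. That copy ends an image, so a 0 precedes it, yet a positive letter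
        precedes \<open>?B l\<close>.\<close>
      proof (cases "i + d < ?B l")
        case True
        let ?q = "?B l - d"
        have Fq: "?F ! ?q = m" using True F0(1)[OF l] m per[of ?q] stop q by auto
        have "?q < length ?F" using d(2) q by linarith
        then obtain l' where l': "l' < length u" "?B l' \<le> ?q" "?q < ?B (Suc l')"
          by (rule image_posE)
        have "?q < ?B l" using d True by simp
        then have "l' < l" using l'(2) image_pos_mono[of l l' img u] by linarith
        then have "?B (Suc l') \<le> ?B l" by (intro image_pos_mono) simp
        have Z: "i \<le> ?q" "?q \<le> i + 2 * d" using True q by linarith+
        have "Suc (u ! l') \<le> m"
          unfolding F0(3)[OF l'(1), symmetric]
          by (rule le) (use B_Suc[OF l'(1)] l' Z q \<open>?B (Suc l') \<le> ?B l\<close> in linarith)+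
        then have "u ! l' < m" by simp
        then have "?q = ?B (Suc l') - 1" using ends[OF l' Z Fq] by simp
        then have "?F ! (?q - 1) = 0" using F0(4)[OF l'(1)] B_Suc[OF l'(1)] by simp
        moreover have "?F ! (?q - 1) = ?F ! (?B l - 1)"
          using per[of "?q - 1"] True Z q by simp
        moreover have "?B l > 0" using True by linarith
        ultimately show False using before[OF l] by simp
      next
        \<comment> \<open>Now \<open>?B l\<close> has a right copy, which must be the second mark.
          So \<open>d = ?n l + 1\<close>, and the positive letter before the block is copied onto
          the final 0 of \<open>pal m\<close>.\<close>
        case F2: False
        have zero: "?F ! (?B l + ?n l) = 0" if "m > 0"
        proof -
          have "pal m \<noteq> []" "last (pal m) = 0" using last_pal that by auto
          then have "img (u ! l) ! (?n l - 1 + 1) = 0"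
            using nth_img(4)[of "?n l - 1" "u ! l"] m by (simp add: last_conv_nth)
          moreover have "?n l - 1 + 1 = ?n l" using \<open>pal m \<noteq> []\<close> m by simp
          ultimately show ?thesis using F[OF l, of "?n l"] by simp
        qed
        have "?F ! (?B l + d) = m" using per[of "?B l"] F0(1)[OF l] F2 False m by simp
        then have "d = ?n l + 1" using in_l[of "?B l + d"] F2 d(1) by simp
        then have "i < ?B l" using stop by simp
        moreover from this have "?B l - 1 + d = ?B l + ?n l" using \<open>d = ?n l + 1\<close> by linarith
        ultimately have "?F ! (?B l - 1) = ?F ! (?B l + ?n l)"
          using per[of "?B l - 1"] F2 by simp
        moreover have "m > 0"
          using before[OF l bpos[OF \<open>i < ?B l\<close>]] le[of "?B l - 1"] \<open>i < ?B l\<close> F2 by linarith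
        ultimately show False using zero before[OF l bpos[OF \<open>i < ?B l\<close>]] by simp
      qed
    qed
  qed
  have boundary: "\<exists>l < length u. ?B (Suc l) = p + 1"
    if p: "i \<le> p" "p \<le> i + 2 * d" "?F ! p = m" for p
  proof -
    obtain l where l: "l < length u" "?B l \<le> p" "p < ?B (Suc l)"
      using image_posE[of p img u] d p by auto
    then show ?thesis using ends[OF l p(1,2,3) strict[OF l p(1,2)]] by auto
  qed
  \<comment> \<open>Both copies of \<open>m\<close> end images, so there are boundaries just after
    them, at distance \<open>d\<close>. The case \<open>r = i + d\<close> accounts for the bound
    \<open>i + d + 1\<close> in \<open>overlap_desubst\<close>.\<close>
  obtain j j' where j: "?B j = r + 1" "?B j' = r + d + 1" "j' \<le> length u"
    using boundary[of r] boundary[of "r + d"] r by (force simp: Suc_le_eq)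
  have "\<not> overlap_free u"
  proof (rule overlap_desubst[of img, OF _ _ _ d per])
    show "i < ?B j" "?B j \<le> i + d + 1" "?B j' = ?B j + d" "j' \<le> length u"
      using j r by auto
  qed (auto simp: img_def)
  then show False using u by simp
qed

text \<open>Strong induction, because \<open>overlap_free_image\<close> asks for overlap-freeness of
  \<open>pal j\<close> for every letter \<open>j\<close> of the preimage.\<close>

lemma overlap_free_pal_snoc: "overlap_free (pal k @ [k])"
proof (induction k rule: less_induct)
  case (less k)
  show ?case
  proof (cases k)
    case 0
    then show ?thesis by (auto simp: overlap_free_def overlap_def sublist_Cons_right)
  next
    case (Suc n)
    have "overlap_free (pal j)" if "j \<in> set (pal n @ [n])" for j
    proof -
      have "j < k" using that set_pal[of n] Suc by auto
      then show ?thesis using less overlap_free_sublist by blast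
    qed
    then show ?thesis unfolding Suc pal_Suc_snoc using less[of n] Suc by (intro overlap_free_image) auto
  qed
qed

section \<open>Palindromes\<close>

text \<open>As \<open>pal j\<close> is a palindrome for \<open>j \<le> n\<close>, a reversed image
  is \<open>Suc j\<close> followed by the square of \<open>pal j @ [j]\<close>. The squares are
  greedy in every context, so only the letters \<open>Suc j\<close> need an argument.\<close>

lemma rev_pal: "rev (pal k) = pal k"
proof (induction k rule: less_induct)
  case (less k)
  show ?case
  proof (cases k)
    case (Suc n)
    define W where "W = pal n @ [n]"
    let ?g = "\<lambda>j. rev (img j)"
    let ?m = "\<lambda>v. concat (map ?g v)"
    have g: "?g j = [Suc j] @ (pal j @ [j]) @ (pal j @ [j])" if "j \<le> n" for j
      using less[of j] that Suc by (simp add: img_def)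
    have greedy: "greedy_after a (pal j @ [j])" for a j
      by (rule greedy_afterI_Nil) (rule greedy_pal_snoc)
    have zero: "\<not> overlap_free (a @ (pal j @ [j]) @ (pal j @ [j]) @ [0])" for a j
    proof -
      obtain r where "pal j @ [j] = 0 # r" using pal_snoc_Cons by blast
      then show ?thesis using not_overlap_free_append[of a 0 r "[]"] by simp
    qed
    have rev_Suc: "rev (pal k) = W @ W @ ?m (pal n)"
      using less[of n] Suc by (simp add: pal_Suc rev_concat rev_map comp_def W_def)
    have le_n: "j \<le> n" if "prefix (v @ [j]) (pal n)" for v j
      using set_mono_prefix[OF that] set_pal[of n] by auto
    have "greedy_after [] (W @ W @ ?m v)" if "prefix v (pal n)" for v
      using that
    proof (induction v rule: rev_induct)
      case Nil
      show ?case using greedy_after_append[of "[]" W W] greedy[of _ n] by (simp add: W_def)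
    next
      case (snoc j v)
      note j = le_n[OF snoc.prems]
      have v: "prefix v (pal n)" using snoc.prems append_prefixD by blast
      have "\<not> overlap_free ((W @ W @ ?m v) @ [d])" if "d < Suc j" for d
      \<comment> \<open>The letter 0 would follow a square that begins with 0. For
        \<open>Suc d'\<close>, the overlap ending \<open>v @ [d']\<close> is transported, the
        reversed images being marked by their first letters \<open>Suc j\<close>.\<close>
      proof (cases d)
        case 0
        show ?thesis
        proof (cases v rule: rev_cases)
          case Nil
          then show ?thesis using zero[of "[]" n] 0 by (simp add: W_def)
        next
          case (snoc v' b)
          then have "b \<le> n" using le_n v by simp
          then show ?thesis
            using zero[of "W @ W @ ?m v' @ [Suc b]" b] 0 snoc g by simp
        qed
      next
        case (Suc d')
        have "greedy_after [] (v @ [j])"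
          using snoc.prems greedy[of "[]" n] by (metis greedy_after_prefix prefix_def)
        then have "\<not> overlap_free (v @ [d'])"
          using greedy_after_snocD[of "[]" v j d'] that Suc by simp
        then have "\<not> overlap_free (?m v @ [Suc d'])"
          by (rule not_overlap_free_image) (simp add: img_def)
        then show ?thesis
          using Suc overlap_free_sublist sublist_append_leftI[of "?m v @ [d]" "W @ W"] by auto
      qed
      then have "greedy_after (W @ W @ ?m v) [Suc j]" by (rule greedy_after_single)
      then have "greedy_after (W @ W @ ?m v) (?g j)"
        unfolding g[OF j] by (intro greedy_after_append greedy)
      then show ?case
        using greedy_after_append[OF snoc.IH[OF v], of "?g j"] by simp
    qed
    then have "greedy_after [] (rev (pal k))" unfolding rev_Suc by simp
    moreover have "greedy_after [] (pal k)"
      using greedy_pal_snoc by (rule greedy_after_prefix)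
    moreover have "overlap_free (pal k)"
      using overlap_free_pal_snoc[of k] overlap_free_sublist by blast
    ultimately show ?thesis by (intro greedy_unique) (simp_all add: overlap_free_rev)
  qed simp
qed

section \<open>Identification of the least words\<close>

lemma psi_0: "\<psi> 0 k = pal k @ [k]"
  unfolding \<psi>_def
proof (rule Least_equality)
  have "hd (pal k @ [k]) = 0" using pal_snoc_Cons[of k] by auto
  then show "overlap_free (pal k @ [k]) \<and> pal k @ [k] \<noteq> [] \<and> hd (pal k @ [k]) = 0
      \<and> last (pal k @ [k]) = k"
    using overlap_free_pal_snoc by simp
next
  fix y assume y: "overlap_free y \<and> y \<noteq> [] \<and> hd y = 0 \<and> last y = k"
  \<comment> \<open>A shorter prefix would lie in \<open>pal k\<close>, where the last letter
    \<open>k\<close> of \<open>y\<close> does not occur.\<close>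
  have "y = pal k @ [k]" if "prefix y (pal k @ [k])"
  proof -
    have "\<not> prefix y (pal k)"
      using y set_mono_prefix[of y "pal k"] set_pal[of k] last_in_set[of y] by auto
    then show ?thesis using that by simp
  qed
  then show "pal k @ [k] \<le> y"
    using greedy_le[OF greedy_pal_snoc, of y k] y by auto
qed

theorem theorem14:
  fixes k :: nat
  shows "inv rotate1 (\<psi> 0 k) = rev (\<psi> 0 k)"
  by (simp add: psi_0 inv_rotate1_snoc rev_pal)

end
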